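(* Let $F$ be a free filter on $\omega$. Then the following are equivalent: (1) the space $N_F$ has the Josefson--Nissenzweig property (JNP); (2) $N_F$ contains a non-trivial convergent sequence; (3) $F\equiv_K Fr$, i.e. $F$ is Katětov equivalent to the Fréchet filter $Fr$.
   Context: A filter $F$ on $\omega$ is free if $\bigcap F=\emptyset$ (equivalently, $F$ contains every cofinite subset of $\omega$); filters are proper ($\emptyset\notin F$). $Fr$ is the filter of all cofinite subsets of $\omega$. For a free filter $F$ on $\omega$, $N_F=\omega\cup\{p_F\}$, where $p_F\notin\omega$ is a fixed point, with the topology in which every point of $\omega$ is isolated and the open neighborhoods of $p_F$ are exactly the sets $A\cup\{p_F\}$ with $A\in F$. A finitely supported measure on a Tychonoff space $X$ is a signed measure $\mu=\sum_{i=1}^n\alpha_i\delta_{x_i}$ with distinct $x_1,\dots,x_n\in X$ and $\alpha_i\in\mathbb{R}\setminus\{0\}$; $\|\mu\|=\sum_i|\alpha_i|$ and $\mu(f)=\sum_i\alpha_i f(x_i)$. $X$ has the Josefson--Nissenzweig property (JNP) if there is a sequence $\langle\mu_n: n\in\omega\rangle$ of finitely supported measures on $X$ with $\|\mu_n\|=1$ for all $n$ and $\mu_n(f)\to0$ for every continuous $f:X\to\mathbb{R}$. A sequence $\langle x_n\rangle$ converging to $x$ is non-trivial if the $x_n$ are pairwise distinct and all different from $x$. For free filters $F,G$ on $\omega$, $F\le_K G$ ($F$ is Katětov below $G$) means there is $f:\omega\to\omega$ such that $f^{-1}[A]\in G$ for every $A\in F$; $F\equiv_K G$ means $F\le_K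 G$ and $G\le_K F$. *)

theory Defs
  imports "HOL-Analysis.Analysis" "HOL-Library.Poly_Mapping"
begin

text \<open>
  A filter on \<open>\<omega>\<close> is an element of \<^typ>\<open>nat filter\<close>: a set \<open>A\<close> belongs to \<open>F\<close> iff
  \<open>\<forall>\<^sub>F n in F. n \<in> A\<close>. The type also contains the improper filter \<^term>\<open>bot\<close>, which is
  therefore excluded explicitly below. The Frechet filter is \<^term>\<open>cofinite :: nat filter\<close>.
\<close>

definition free_filter :: "'a filter \<Rightarrow> bool" where
  "free_filter F \<longleftrightarrow> F \<noteq> bot \<and> \<Inter>{A. \<forall>\<^sub>F n in F. n \<in> A} = {}"

definition katetov_le :: "'a filter \<Rightarrow> 'b filter \<Rightarrow> bool" where
  "katetov_le F G \<longleftrightarrow>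
     (\<exists>f :: 'b \<Rightarrow> 'a. \<forall>A. (\<forall>\<^sub>F n in F. n \<in> A) \<longrightarrow> (\<forall>\<^sub>F m in G. m \<in> f -` A))"

definition katetov_equiv :: "'a filter \<Rightarrow> 'b filter \<Rightarrow> bool" where
  "katetov_equiv F G \<longleftrightarrow> katetov_le F G \<and> katetov_le G F"

text \<open>
  The space \<open>N\<^sub>F\<close> lives on \<^typ>\<open>nat option\<close>: \<^term>\<open>None\<close> is the extra point \<open>p\<^sub>F\<close> and
  \<^term>\<open>Some n\<close> is the point \<open>n\<close> of \<open>\<omega>\<close>.
\<close>

definition N_space :: "nat filter \<Rightarrow> nat option topology" where
  "N_space F = topology (\<lambda>U. None \<in> U \<longrightarrow> (\<forall>\<^sub>F n in F. Some n \<in> U))"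

lemma openin_N_space:
  "openin (N_space F) U \<longleftrightarrow> (None \<in> U \<longrightarrow> (\<forall>\<^sub>F n in F. Some n \<in> U))"
proof -
  have "istopology (\<lambda>U. None \<in> U \<longrightarrow> (\<forall>\<^sub>F n in F. Some n \<in> U))"
    unfolding istopology_def
  proof (intro conjI allI impI)
    fix S T :: "nat option set"
    assume "None \<in> S \<longrightarrow> (\<forall>\<^sub>F n in F. Some n \<in> S)"
      and "None \<in> T \<longrightarrow> (\<forall>\<^sub>F n in F. Some n \<in> T)" and "None \<in> S \<inter> T"
    then show "\<forall>\<^sub>F n in F. Some n \<in> S \<inter> T"
      by (simp add: eventually_conj)
  next
    fix K :: "nat option set set"
    assume K: "\<forall>S\<in>K. None \<in> S \<longrightarrow> (\<forall>\<^sub>F n in F. Some n \<in> S)" and "None \<in> \<Union>K"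
    then obtain S where S: "S \<in> K" "\<forall>\<^sub>F n in F. Some n \<in> S"
      by blast
    from S(2) show "\<forall>\<^sub>F n in F. Some n \<in> \<Union>K"
      by (rule eventually_mono) (use S(1) in blast)
  qed
  then show ?thesis
    by (simp add: N_space_def topology_inverse')
qed

lemma topspace_N_space [simp]: "topspace (N_space F) = UNIV"
proof -
  have "openin (N_space F) UNIV"
    by (simp add: openin_N_space)
  then show ?thesis
    using openin_subset by blast
qed

lemma openin_N_space_Some: "openin (N_space F) {Some n}"
  by (simp add: openin_N_space)

lemma openin_N_space_None:
  "openin (N_space F) U \<and> None \<in> U \<longleftrightarrow>
     (\<exists>A. (\<forall>\<^sub>F n in F. n \<in> A) \<and> U = insert None (Some ` A))"
proof
  assume U: "openin (N_space F) U \<and> None \<in> U"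
  have "U = insert None (Some ` {n. Some n \<in> U})"
  proof (rule set_eqI)
    show "x \<in> U \<longleftrightarrow> x \<in> insert None (Some ` {n. Some n \<in> U})" for x
      using U by (cases x) auto
  qed
  then show "\<exists>A. (\<forall>\<^sub>F n in F. n \<in> A) \<and> U = insert None (Some ` A)"
    using U by (intro exI[of _ "{n. Some n \<in> U}"]) (simp add: openin_N_space)
qed (auto simp: openin_N_space image_iff)

text \<open>
  A finitely supported measure \<open>\<Sum>\<^sub>i \<alpha>\<^sub>i \<delta>\<^bsub>x\<^sub>i\<^esub>\<close> is given by its coefficient function, a finitely
  supported function \<open>\<mu>\<close> with \<open>lookup \<mu> x\<^sub>i = \<alpha>\<^sub>i\<close> and \<open>keys \<mu> = {x\<^sub>1, \<dots>, x\<^sub>n}\<close>.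
\<close>

definition fs_norm :: "('a \<Rightarrow>\<^sub>0 real) \<Rightarrow> real" where
  "fs_norm \<mu> = (\<Sum>x\<in>Poly_Mapping.keys \<mu>. \<bar>Poly_Mapping.lookup \<mu> x\<bar>)"

definition fs_integral :: "('a \<Rightarrow>\<^sub>0 real) \<Rightarrow> ('a \<Rightarrow> real) \<Rightarrow> real" where
  "fs_integral \<mu> f = (\<Sum>x\<in>Poly_Mapping.keys \<mu>. Poly_Mapping.lookup \<mu> x * f x)"

definition JNP :: "'a topology \<Rightarrow> bool" where
  "JNP X \<longleftrightarrow>
     (\<exists>\<mu> :: nat \<Rightarrow> 'a \<Rightarrow>\<^sub>0 real.
        (\<forall>n. Poly_Mapping.keys (\<mu> n) \<subseteq> topspace X \<and> fs_norm (\<mu> n) = 1) \<and>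
        (\<forall>f. continuous_map X euclideanreal f \<longrightarrow> (\<lambda>n. fs_integral (\<mu> n) f) \<longlonglongrightarrow> 0))"

definition has_nontrivial_convergent_seq :: "'a topology \<Rightarrow> bool" where
  "has_nontrivial_convergent_seq X \<longleftrightarrow>
     (\<exists>x l. range x \<subseteq> topspace X \<and> limitin X x l sequentially \<and> inj x \<and> (\<forall>n :: nat. x n \<noteq> l))"

end

theory Submission
  imports Defs
begin

text \<open>
  The substantial implication is the one from the JNP to a convergent sequence. If \<open>\<mu>\<^sub>n\<close> witnesses
  the JNP, let \<open>U \<subseteq> \<omega>\<close> be the union of the supports (without \<open>p\<^sub>F\<close>). For \<open>A \<in> F\<close> any real
  function vanishing on \<open>A \<union> {p\<^sub>F}\<close> is continuous, bounded or not; if \<open>U - A\<close> were infinite, then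
  solving a triangular system would give such a function \<open>f\<close> with \<open>\<mu>\<^sub>n(f) = 1\<close> for infinitely many
  \<open>n\<close>. So \<open>U - A\<close> is finite for all \<open>A \<in> F\<close>, and an infinite \<open>U\<close> enumerates to a sequence
  converging to \<open>p\<^sub>F\<close>. If \<open>U\<close> is finite, then testing against the indicators of the points of \<open>U\<close>
  and against the constant \<open>1\<close> shows that all coefficients tend to \<open>0\<close>, which contradicts
  \<open>\<parallel>\<mu>\<^sub>n\<parallel> = 1\<close>.
\<close>

section \<open>Norms and integrals of finitely supported measures\<close>

lemma fs_norm_superset:
  assumes "finite S" "Poly_Mapping.keys \<mu> \<subseteq> S"
  shows "fs_norm \<mu> = (\<Sum>x\<in>S. \<bar>Poly_Mapping.lookup \<mu> x\<bar>)"
  unfolding fs_norm_def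
  by (rule sum.mono_neutral_left) (use assms in \<open>auto simp: in_keys_iff\<close>)

lemma fs_integral_superset:
  assumes "finite S" "Poly_Mapping.keys \<mu> \<subseteq> S"
  shows "fs_integral \<mu> f = (\<Sum>x\<in>S. Poly_Mapping.lookup \<mu> x * f x)"
  unfolding fs_integral_def
  by (rule sum.mono_neutral_left) (use assms in \<open>auto simp: in_keys_iff\<close>)

lemma fs_integral_indicator:
  "fs_integral \<mu> (indicator {x}) = Poly_Mapping.lookup \<mu> x"
proof -
  have "fs_integral \<mu> (indicator {x}) =
    (\<Sum>y\<in>insert x (Poly_Mapping.keys \<mu>). Poly_Mapping.lookup \<mu> y * indicator {x} y)"
    by (rule fs_integral_superset) auto
  also have "\<dots> = (\<Sum>y\<in>{x}. Poly_Mapping.lookup \<mu> y * indicator {x} y)"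
    by (rule sum.mono_neutral_right) auto
  finally show ?thesis by simp
qed

section \<open>Triangular systems and unbounded test functions\<close>

lemma triangular_system_solvable:
  fixes a :: "nat \<Rightarrow> nat \<Rightarrow> 'a::field"
  assumes "\<And>n. n \<in> N \<Longrightarrow> a n n \<noteq> 0"
  shows "\<exists>g. \<forall>n\<in>N. (\<Sum>m\<in>N \<inter> {..n}. a n m * g m) = b n"
proof -
  \<comment> \<open>Forward substitution: equation \<open>n\<close> determines \<open>g n\<close>
    from the earlier values. Outside \<open>N\<close> the formula assigns some value too, but sums
    over \<open>N\<close> never see it.\<close>
  have "\<exists>g. \<forall>n. g n = (b n - (\<Sum>m\<in>N \<inter> {..<n}. a n m * g m)) / a n n"
    by (rule dependent_wellorder_choice) auto
  then obtain g where g: "\<And>n. g n = (b n - (\<Sum>m\<in>N \<inter> {..<n}. a n m * g m)) / a n n"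
    by blast
  have "(\<Sum>m\<in>N \<inter> {..n}. a n m * g m) = b n" if "n \<in> N" for n
  proof -
    have "N \<inter> {..n} = insert n (N \<inter> {..<n})"
      using that by auto
    then have "(\<Sum>m\<in>N \<inter> {..n}. a n m * g m) = a n n * g n + (\<Sum>m\<in>N \<inter> {..<n}. a n m * g m)"
      by simp
    also have "a n n * g n = b n - (\<Sum>m\<in>N \<inter> {..<n}. a n m * g m)"
      using assms[OF that] by (subst g) simp
    finally show ?thesis by simp
  qed
  then show ?thesis by blast
qed

text \<open>Infinitely many of the measures charge a point of \<open>V\<close> that no earlier
  measure charges. On these points the coefficients form a lower triangular matrix with nonzero
  diagonal, so the integrals of a function living there can be prescribed.\<close>

lemma unbounded_support_test_function:
  fixes \<mu> :: "nat \<Rightarrow> 'a \<Rightarrow>\<^sub>0 real"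
  assumes inf: "infinite (\<Union>n. Poly_Mapping.keys (\<mu> n) \<inter> V)"
  shows "\<exists>f. (\<forall>x. x \<notin> V \<longrightarrow> f x = 0) \<and> (\<exists>\<^sub>\<infinity>n. fs_integral (\<mu> n) f = 1)"
proof -
  define T where "T n = Poly_Mapping.keys (\<mu> n) \<inter> V" for n
  \<comment> \<open>The indices at which a new point of \<open>V\<close> appears. Each point of the
    union first appears at such an index, and each index contributes finitely many points, so
    \<open>N\<close> is infinite.\<close>
  define N where "N = {n. \<not> T n \<subseteq> (\<Union>m<n. T m)}"
  have new: "\<exists>n\<in>N. x \<in> T n" if "x \<in> T n" for x n
    using that
  proof (induction n rule: less_induct)
    case (less n)
    then show ?case
      by (cases "n \<in> N") (auto simp: N_def)
  qed
  have "(\<Union>n. T n) = (\<Union>n\<in>N. T n)"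
    using new by blast
  then have "infinite (\<Union>n\<in>N. T n)"
    using inf by (simp add: T_def)
  moreover have "finite (T n)" for n
    by (simp add: T_def)
  ultimately have "infinite N"
    by blast
  have "\<forall>n\<in>N. \<exists>x. x \<in> T n \<and> (\<forall>m<n. x \<notin> T m)"
    by (auto simp: N_def)
  then obtain k where k: "\<And>n. n \<in> N \<Longrightarrow> k n \<in> T n"
      and k_new: "\<And>n m. n \<in> N \<Longrightarrow> m < n \<Longrightarrow> k n \<notin> T m"
    by metis
  have inj: "inj_on k N"
    by (intro linorder_inj_onI') (use k k_new in metis)
  \<comment> \<open>The diagonal entries are nonzero because \<open>k n\<close> lies in the support
    of \<open>\<mu> n\<close>. The entries with \<open>m > n\<close> vanish because
    \<open>k m\<close> is new at stage \<open>m\<close>, so the sum over \<open>m \<le> n\<close>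
    will be the full integral.\<close>
  obtain g where g: "\<And>n. n \<in> N \<Longrightarrow>
      (\<Sum>m\<in>N \<inter> {..n}. Poly_Mapping.lookup (\<mu> n) (k m) * g m) = 1"
    using triangular_system_solvable[of N "\<lambda>n m. Poly_Mapping.lookup (\<mu> n) (k m)" "\<lambda>_. 1"] k
    by (auto simp: T_def in_keys_iff)
  define f where "f x = (if x \<in> k ` N then g (inv_into N k x) else 0)" for x
  have f_k: "f (k n) = g n" if "n \<in> N" for n
    using that inj by (simp add: f_def)
  have "f x = 0" if "x \<notin> V" for x
    using that k by (auto simp: f_def T_def)
  moreover have "fs_integral (\<mu> n) f = 1" if "n \<in> N" for n
  proof -
    let ?S = "k ` (N \<inter> {..n})"
    \<comment> \<open>A support point outside \<open>?S\<close> is either off the range of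
      \<open>k\<close>, where \<open>f\<close> is 0, or equal to \<open>k m\<close> with
      \<open>m > n\<close>, which \<open>\<mu> n\<close> does not charge.\<close>
    have zero: "Poly_Mapping.lookup (\<mu> n) x * f x = 0"
      if "x \<in> Poly_Mapping.keys (\<mu> n) \<union> ?S - ?S" for x
    proof (cases "x \<in> k ` N")
      case True
      then obtain m where m: "m \<in> N" "x = k m" by blast
      with that have "n < m" by auto
      then have "k m \<notin> Poly_Mapping.keys (\<mu> n)"
        using k_new[OF m(1)] k[OF m(1)] by (auto simp: T_def)
      with m show ?thesis by (simp add: in_keys_iff)
    qed (simp add: f_def)
    have "fs_integral (\<mu> n) f =
        (\<Sum>x\<in>Poly_Mapping.keys (\<mu> n) \<union> ?S. Poly_Mapping.lookup (\<mu> n) x * f x)"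
      by (rule fs_integral_superset) auto
    also have "\<dots> = (\<Sum>x\<in>?S. Poly_Mapping.lookup (\<mu> n) x * f x)"
      by (rule sum.mono_neutral_right) (use zero in auto)
    also have "\<dots> = (\<Sum>m\<in>N \<inter> {..n}. Poly_Mapping.lookup (\<mu> n) (k m) * f (k m))"
      by (subst sum.reindex) (auto intro: inj_on_subset[OF inj])
    also have "\<dots> = 1"
      using g[OF that] f_k by simp
    finally show ?thesis .
  qed
  then have "\<exists>\<^sub>\<infinity>n. fs_integral (\<mu> n) f = 1"
    unfolding INFM_iff_infinite
    by (intro infinite_super[OF _ \<open>infinite N\<close>]) blast
  ultimately show ?thesis by blast
qed

section \<open>From a convergent sequence to the JNP\<close>

lemma JNP_if_nontrivial_convergent_seq:
  assumes "has_nontrivial_convergent_seq X"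
  shows "JNP X"
proof -
  obtain x l where x: "range x \<subseteq> topspace X" and lim: "limitin X x l sequentially"
      and ne: "\<And>n :: nat. x n \<noteq> l"
    using assms by (auto simp: has_nontrivial_convergent_seq_def)
  have l: "l \<in> topspace X"
    using lim by (rule limitin_topspace)
  \<comment> \<open>Half the difference of the Dirac measures at \<open>x n\<close> and
    \<open>l\<close>: as \<open>x n\<close> differs from \<open>l\<close>, nothing cancels and the
    norm is 1, while continuity at \<open>l\<close> sends the integrals to 0.\<close>
  define \<mu> :: "nat \<Rightarrow> 'a \<Rightarrow>\<^sub>0 real" where
    "\<mu> n = Poly_Mapping.single (x n) (1/2) + Poly_Mapping.single l (-1/2)" for n
  have lookup: "Poly_Mapping.lookup (\<mu> n) (x n) = 1/2"
      "Poly_Mapping.lookup (\<mu> n) l = -1/2" for n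
    using ne[of n] by (auto simp: \<mu>_def lookup_add lookup_single)
  have keys: "Poly_Mapping.keys (\<mu> n) \<subseteq> {x n, l}" for n
    by (auto simp: \<mu>_def in_keys_iff lookup_add lookup_single when_def split: if_splits)
  have "fs_norm (\<mu> n) = 1" for n
    using fs_norm_superset[OF _ keys[of n]] ne[of n] by (simp add: lookup)
  moreover have "(\<lambda>n. fs_integral (\<mu> n) f) \<longlonglongrightarrow> 0" if f: "continuous_map X euclideanreal f" for f
  proof -
    have "limitin euclideanreal (f \<circ> x) (f l) sequentially"
      using f lim by (rule continuous_map_limit)
    then have "(\<lambda>n. f (x n)) \<longlonglongrightarrow> f l"
      by (simp add: o_def)
    then have "(\<lambda>n. (f (x n) - f l) / 2) \<longlonglongrightarrow> (f l - f l) / 2"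
      by (intro tendsto_intros) auto
    moreover have "fs_integral (\<mu> n) f = (f (x n) - f l) / 2" for n
      using fs_integral_superset[OF _ keys[of n]] ne[of n] by (simp add: lookup field_simps)
    ultimately show ?thesis by (simp only: diff_self div_0)
  qed
  moreover have "Poly_Mapping.keys (\<mu> n) \<subseteq> topspace X" for n
    using keys[of n] x l by blast
  ultimately show ?thesis
    unfolding JNP_def by blast
qed

section \<open>Convergent sequences as limits along the filter\<close>

lemma limitin_N_space_None:
  "limitin (N_space F) (\<lambda>i. Some (f i)) None G \<longleftrightarrow> filterlim f F G"
proof
  assume lim: "limitin (N_space F) (\<lambda>i. Some (f i)) None G"
  show "filterlim f F G"
    unfolding filterlim_iff
  proof (intro allI impI)
    fix P assume "eventually P F"
    then have "openin (N_space F) (insert None (Some ` Collect P))"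
      by (auto simp: openin_N_space image_iff)
    then have "\<forall>\<^sub>F i in G. Some (f i) \<in> insert None (Some ` Collect P)"
      using lim unfolding limitin_def by blast
    then show "\<forall>\<^sub>F i in G. P (f i)"
      by (simp add: image_iff)
  qed
next
  assume "filterlim f F G"
  then show "limitin (N_space F) (\<lambda>i. Some (f i)) None G"
    by (auto simp: limitin_def openin_N_space filterlim_iff)
qed

text \<open>Points of \<omega> are isolated, so a sequence avoiding its limit can only converge to
  \<open>None\<close>; there convergence is exactly \<open>filterlim\<close>.\<close>

lemma has_nontrivial_convergent_seq_N_space_iff:
  "has_nontrivial_convergent_seq (N_space F) \<longleftrightarrow>
     (\<exists>f :: nat \<Rightarrow> nat. inj f \<and> filterlim f F sequentially)"
proof
  assume "has_nontrivial_convergent_seq (N_space F)"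
  then obtain x l where lim: "limitin (N_space F) x l sequentially" and "inj x"
      and ne: "\<And>n :: nat. x n \<noteq> l"
    by (auto simp: has_nontrivial_convergent_seq_def)
  have "l = None"
  proof (rule ccontr)
    assume "l \<noteq> None"
    then have "openin (N_space F) {l}"
      by (auto simp: openin_N_space_Some)
    then have "\<forall>\<^sub>F n in sequentially. x n \<in> {l}"
      using lim unfolding limitin_def by blast
    then show False
      using ne by simp
  qed
  with ne have "\<forall>n. \<exists>k. x n = Some k"
    by simp
  then obtain f where x: "x = (\<lambda>n. Some (f n))"
    by (metis ext)
  have "inj f"
    using \<open>inj x\<close> by (simp add: x inj_def)
  moreover have "filterlim f F sequentially"
    using lim by (simp add: x \<open>l = None\<close> limitin_N_space_None)
  ultimately show "\<exists>f :: nat \<Rightarrow> nat. inj f \<and> filterlim f F sequentially"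
    by blast
next
  assume "\<exists>f :: nat \<Rightarrow> nat. inj f \<and> filterlim f F sequentially"
  then obtain f :: "nat \<Rightarrow> nat" where "inj f" "filterlim f F sequentially"
    by blast
  then show "has_nontrivial_convergent_seq (N_space F)"
    unfolding has_nontrivial_convergent_seq_def
    by (intro exI[of _ "\<lambda>n. Some (f n)"] exI[of _ None]) (auto simp: limitin_N_space_None inj_def)
qed

section \<open>Comparison with the Frechet filter\<close>

lemma katetov_le_iff_filterlim:
  "katetov_le F G \<longleftrightarrow> (\<exists>f. filterlim f F G)"
proof -
  have "(\<forall>A. (\<forall>\<^sub>F n in F. n \<in> A) \<longrightarrow> (\<forall>\<^sub>F m in G. m \<in> f -` A)) \<longleftrightarrow> filterlim f F G" for f
  proof
    assume *: "\<forall>A. (\<forall>\<^sub>F n in F. n \<in> A) \<longrightarrow> (\<forall>\<^sub>F m in G. m \<in> f -` A)"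
    show "filterlim f F G"
      unfolding filterlim_iff
    proof (intro allI impI)
      show "\<forall>\<^sub>F m in G. P (f m)" if "eventually P F" for P
        using *[rule_format, of "Collect P"] that by simp
    qed
  next
    assume "filterlim f F G"
    then show "\<forall>A. (\<forall>\<^sub>F n in F. n \<in> A) \<longrightarrow> (\<forall>\<^sub>F m in G. m \<in> f -` A)"
      by (auto dest: eventually_compose_filterlim)
  qed
  then show ?thesis
    by (simp add: katetov_le_def)
qed

text \<open>Freeness gives, for each point, a member of \<open>F\<close> omitting it; intersecting
  finitely many of them removes any finite set. The order on filters reverses inclusion, so this
  says that \<open>F\<close> extends the Frechet filter.\<close>

lemma free_filter_le_cofinite:
  assumes "free_filter F"
  shows "F \<le> cofinite"
proof -
  have "\<forall>\<^sub>F n in F. n \<noteq> x" for x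
  proof -
    obtain A where A: "\<forall>\<^sub>F n in F. n \<in> A" "x \<notin> A"
      using assms by (auto simp: free_filter_def)
    from A(1) show ?thesis
      by (rule eventually_mono) (use A(2) in blast)
  qed
  then have *: "\<forall>\<^sub>F n in F. \<forall>x\<in>{n. \<not> P n}. n \<noteq> x" if "finite {n. \<not> P n}" for P
    using that by (intro eventually_ball_finite) auto
  have "eventually P F" if "finite {n. \<not> P n}" for P
    by (rule eventually_mono[OF *[OF that]]) auto
  then show ?thesis
    by (simp add: le_filter_def eventually_cofinite)
qed

text \<open>The increasing enumeration of \<open>U\<close> is injective, so it meets the finite part
  of \<open>U\<close> outside a member of \<open>F\<close> only finitely often. It is applied to the
  range of a Katetov map and to the union of the supports.\<close>

lemma inj_sequence_from_pseudo_intersection: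
  fixes F :: "nat filter"
  assumes "infinite U" and fin: "\<And>P. eventually P F \<Longrightarrow> finite {k \<in> U. \<not> P k}"
  shows "\<exists>f :: nat \<Rightarrow> nat. inj f \<and> filterlim f F sequentially"
proof (intro exI conjI)
  show inj: "inj (enumerate U)"
    using \<open>infinite U\<close> by (rule inj_enumerate)
  show "filterlim (enumerate U) F sequentially"
    unfolding filterlim_iff
  proof (intro allI impI)
    fix P assume "eventually P F"
    then have "finite (enumerate U -` {k \<in> U. \<not> P k})"
      by (intro finite_vimageI fin inj)
    then have "finite {n. \<not> P (enumerate U n)}"
      using enumerate_in_set[OF \<open>infinite U\<close>] by (simp add: vimage_def)
    then show "\<forall>\<^sub>F n in sequentially. P (enumerate U n)"
      unfolding cofinite_eq_sequentially[symmetric] by (simp add: eventually_cofinite)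
  qed
qed

lemma katetov_equiv_cofinite_iff:
  fixes F :: "nat filter"
  assumes "free_filter F"
  shows "katetov_equiv F (cofinite :: nat filter) \<longleftrightarrow>
     (\<exists>f :: nat \<Rightarrow> nat. inj f \<and> filterlim f F sequentially)"
proof
  assume "katetov_equiv F (cofinite :: nat filter)"
  then obtain f where f: "filterlim f F (sequentially :: nat filter)"
    by (auto simp: katetov_equiv_def katetov_le_iff_filterlim cofinite_eq_sequentially)
  \<comment> \<open>The map \<open>f\<close> may repeat values, so an injective sequence is
    extracted from its range. A finite range would have its complement in \<open>F\<close>, which
    \<open>f\<close> would then have to enter.\<close>
  have "infinite (range f)"
  proof
    assume "finite (range f)"
    then have "\<forall>\<^sub>F n in F. n \<notin> range f"
      using free_filter_le_cofinite[OF assms] by (simp add: le_filter_def eventually_cofinite)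
    then have "\<forall>\<^sub>F m in sequentially. f m \<notin> range f"
      using f unfolding filterlim_iff by blast
    then show False
      by simp
  qed
  moreover have "finite {k \<in> range f. \<not> P k}" if "eventually P F" for P
  proof -
    have "finite {m. \<not> P (f m)}"
      using f that unfolding filterlim_iff cofinite_eq_sequentially[symmetric] eventually_cofinite
      by blast
    moreover have "{k \<in> range f. \<not> P k} = f ` {m. \<not> P (f m)}"
      by blast
    ultimately show ?thesis
      by simp
  qed
  ultimately show "\<exists>f :: nat \<Rightarrow> nat. inj f \<and> filterlim f F sequentially"
    by (rule inj_sequence_from_pseudo_intersection)
next
  assume "\<exists>f :: nat \<Rightarrow> nat. inj f \<and> filterlim f F sequentially"
  then have "katetov_le F (cofinite :: nat filter)"
    by (auto simp: katetov_le_iff_filterlim cofinite_eq_sequentially)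
  \<comment> \<open>The identity is a witness, since \<open>F\<close> extends the Frechet
    filter.\<close>
  moreover have "katetov_le (cofinite :: nat filter) F"
    unfolding katetov_le_iff_filterlim
    using free_filter_le_cofinite[OF assms] by (auto simp: filterlim_def intro: exI[of _ "\<lambda>n. n"])
  ultimately show "katetov_equiv F (cofinite :: nat filter)"
    by (simp add: katetov_equiv_def)
qed

section \<open>From the JNP to a convergent sequence\<close>

lemma continuous_map_N_space_vanishing:
  fixes f :: "nat option \<Rightarrow> 'a::{topological_space,zero}"
  assumes "f None = 0" "\<forall>\<^sub>F n in F. f (Some n) = 0"
  shows "continuous_map (N_space F) euclidean f"
  unfolding continuous_map_def
proof (intro conjI allI impI)
  fix W :: "'a set"
  \<comment> \<open>If the preimage contains \<open>None\<close>, then \<open>W\<close> contains 0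
    and the preimage contains the zero set of \<open>f\<close>; otherwise it consists of isolated
    points.\<close>
  show "openin (N_space F) {x \<in> topspace (N_space F). f x \<in> W}"
    using assms(2) by (auto simp: openin_N_space assms(1) elim!: eventually_mono)
qed simp

lemma N_space_JNP_imp_nontrivial_convergent_seq:
  assumes "free_filter F" "JNP (N_space F)"
  shows "has_nontrivial_convergent_seq (N_space F)"
proof -
  obtain \<mu> :: "nat \<Rightarrow> nat option \<Rightarrow>\<^sub>0 real" where norm: "\<And>n. fs_norm (\<mu> n) = 1"
    and lim: "\<And>f. continuous_map (N_space F) euclideanreal f \<Longrightarrow>
      (\<lambda>n. fs_integral (\<mu> n) f) \<longlonglongrightarrow> 0"
    using assms(2) by (auto simp: JNP_def)
  define U where "U = {k. \<exists>n. Some k \<in> Poly_Mapping.keys (\<mu> n)}"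
  have almost_subset: "finite (U - A)" if A: "\<forall>\<^sub>F n in F. n \<in> A" for A
  proof (rule ccontr)
    assume "infinite (U - A)"
    then have "infinite (Some ` (U - A))"
      by (simp add: finite_image_iff)
    \<comment> \<open>With \<open>V\<close> the part of \<omega> outside \<open>A\<close>, the test
      function vanishes on \<open>A\<close> and at \<open>None\<close>, which makes it
      continuous.\<close>
    also have "Some ` (U - A) = (\<Union>n. Poly_Mapping.keys (\<mu> n) \<inter> Some ` (- A))"
      by (auto simp: U_def)
    finally obtain f where f: "\<And>x. x \<notin> Some ` (- A) \<Longrightarrow> f x = 0"
        and one: "\<exists>\<^sub>\<infinity>n. fs_integral (\<mu> n) f = 1"
      using unbounded_support_test_function by metis
    have "continuous_map (N_space F) euclideanreal f"
      by (rule continuous_map_N_space_vanishing) (use f A in \<open>auto elim!: eventually_mono\<close>)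
    from lim[OF this] have "\<forall>\<^sub>F n in sequentially. fs_integral (\<mu> n) f < 1"
      by (rule order_tendstoD) simp
    then have "\<forall>\<^sub>\<infinity>n. fs_integral (\<mu> n) f \<noteq> 1"
      unfolding cofinite_eq_sequentially by (rule eventually_mono) simp
    with one show False
      by (simp add: frequently_def)
  qed
  have "infinite U"
  proof
    assume "finite U"
    define S where "S = insert None (Some ` U)"
    have S: "finite S" "Poly_Mapping.keys (\<mu> n) \<subseteq> S" for n
    proof -
      show "Poly_Mapping.keys (\<mu> n) \<subseteq> S"
      proof
        show "x \<in> S" if "x \<in> Poly_Mapping.keys (\<mu> n)" for x
          using that by (cases x) (auto simp: S_def U_def)
      qed
    qed (simp add: S_def \<open>finite U\<close>)
    \<comment> \<open>The indicator of an isolated point is continuous: it vanishes at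
      \<open>None\<close> and on a cofinite set, which belongs to \<open>F\<close>.\<close>
    have Some_lim: "(\<lambda>n. Poly_Mapping.lookup (\<mu> n) (Some k)) \<longlonglongrightarrow> 0" for k
    proof -
      have "\<forall>\<^sub>F n in F. n \<noteq> k"
        using free_filter_le_cofinite[OF assms(1)] by (simp add: le_filter_def eventually_cofinite)
      then have "continuous_map (N_space F) euclideanreal (indicator {Some k})"
        by (intro continuous_map_N_space_vanishing) (auto elim!: eventually_mono)
      from lim[OF this] show ?thesis
        by (simp add: fs_integral_indicator)
    qed
    \<comment> \<open>The indicator of \<open>None\<close> is not continuous, so the coefficient
      there is recovered as the total mass minus the finitely many coefficients on
      \<open>U\<close>.\<close>
    have "(\<lambda>n. fs_integral (\<mu> n) (\<lambda>_. 1)) \<longlonglongrightarrow> 0"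
      by (rule lim) simp
    moreover have "fs_integral (\<mu> n) (\<lambda>_. 1) =
        Poly_Mapping.lookup (\<mu> n) None + (\<Sum>k\<in>U. Poly_Mapping.lookup (\<mu> n) (Some k))" for n
      using fs_integral_superset[OF S, of n "\<lambda>_. 1"] \<open>finite U\<close>
      by (simp add: S_def sum.reindex)
    moreover have "(\<lambda>n. \<Sum>k\<in>U. Poly_Mapping.lookup (\<mu> n) (Some k)) \<longlonglongrightarrow> 0"
      using tendsto_sum[of U, OF Some_lim] by simp
    ultimately have "(\<lambda>n. Poly_Mapping.lookup (\<mu> n) None) \<longlonglongrightarrow> 0"
      using tendsto_diff by fastforce
    then have "(\<lambda>n. Poly_Mapping.lookup (\<mu> n) x) \<longlonglongrightarrow> 0" for x
      using Some_lim by (cases x) auto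
    \<comment> \<open>All supports lie in the one finite set \<open>S\<close>, so coefficientwise
      convergence forces the norms, constantly 1, to tend to 0.\<close>
    then have "(\<lambda>n. \<Sum>x\<in>S. \<bar>Poly_Mapping.lookup (\<mu> n) x\<bar>) \<longlonglongrightarrow> (\<Sum>x\<in>S. 0)"
      by (intro tendsto_sum tendsto_rabs_zero)
    then have "(\<lambda>n. fs_norm (\<mu> n)) \<longlonglongrightarrow> 0"
      using fs_norm_superset[OF S] by simp
    then show False
      by (simp add: norm LIMSEQ_const_iff)
  qed
  moreover have "finite {k \<in> U. \<not> P k}" if "eventually P F" for P
    using almost_subset[of "Collect P"] that by (simp add: set_diff_eq)
  ultimately show ?thesis
    unfolding has_nontrivial_convergent_seq_N_space_iff
    by (rule inj_sequence_from_pseudo_intersection)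
qed

theorem theorem1p1:
  fixes F :: "nat filter"
  assumes "free_filter F"
  shows "(JNP (N_space F) \<longleftrightarrow> has_nontrivial_convergent_seq (N_space F)) \<and>
         (has_nontrivial_convergent_seq (N_space F) \<longleftrightarrow> katetov_equiv F (cofinite :: nat filter))"
  using JNP_if_nontrivial_convergent_seq N_space_JNP_imp_nontrivial_convergent_seq[OF assms]
    has_nontrivial_convergent_seq_N_space_iff katetov_equiv_cofinite_iff[OF assms]
  by blast

end
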